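(* The set $U_{\mathrm N}(\ell^{\infty})$ of nearly universal functions is nowhere dense in $(C(\mathbb{R}),d_{\infty})$. In particular, the set $U(\ell^{\infty})$ of universal functions is nowhere dense in $(C(\mathbb{R}),d_{\infty})$.
   Context: $C(\mathbb{R})$ denotes the set of continuous functions $f:\mathbb{R}\to\mathbb{R}$ (not necessarily bounded), equipped with the metric $d_{\infty}(f,g)=\min(\|f-g\|_{\infty},1)$, where $\|f-g\|_{\infty}=\sup_{x\in\mathbb{R}}|f(x)-g(x)|\in[0,\infty]$. $\ell^{\infty}$ denotes the space of bounded real sequences $(x_n)_n$, where the index $n$ ranges over all integers. The set of universal functions is $$U(\ell^{\infty})=\{f\in C(\mathbb{R}) : \text{for every } (x_n)_n\in \ell^{\infty} \text{ there is } t\in\mathbb{R} \text{ such that } x_n=f(t+n) \text{ for all integers } n\},$$ and the set of nearly universal functions is $$U_{\mathrm N}(\ell^{\infty})=\{f\in C(\mathbb{R}) : \text{for every } (x_n)_n\in \ell^{\infty},\ \inf_{t\in\mathbb{R}}\sup_{n}|f(t+n)-x_n|=0\},$$ where the supremum is over all integers $n$ and takes values in $[0,\infty]$. *)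

theory Defs
  imports "HOL-Analysis.Analysis"
begin

definition C_R :: "(real \<Rightarrow> real) set" where
  "C_R = {f. continuous_on UNIV f}"

definition sup_dist :: "(real \<Rightarrow> real) \<Rightarrow> (real \<Rightarrow> real) \<Rightarrow> ereal" where
  "sup_dist f g = (SUP x. ereal \<bar>f x - g x\<bar>)"

text \<open>The minimum lies in \<open>[0, 1]\<close>, so \<^const>\<open>real_of_ereal\<close> is only applied to finite values.\<close>

definition d_inf :: "(real \<Rightarrow> real) \<Rightarrow> (real \<Rightarrow> real) \<Rightarrow> real" where
  "d_inf f g = real_of_ereal (min (sup_dist f g) 1)"

lemma sup_dist_upper: "ereal \<bar>f x - g x\<bar> \<le> sup_dist f g"
  unfolding sup_dist_def by (rule SUP_upper) simp

lemma sup_dist_nonneg: "0 \<le> sup_dist f g"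
  using sup_dist_upper[of f 0 g] by (rule order_trans[rotated]) simp

lemma ereal_d_inf: "ereal (d_inf f g) = min (sup_dist f g) 1"
proof -
  have "\<bar>min (sup_dist f g) 1\<bar> \<noteq> \<infinity>"
    using sup_dist_nonneg[of f g] by (cases "sup_dist f g") (auto simp: min_def)
  then show ?thesis
    by (simp add: d_inf_def ereal_real)
qed

lemma sup_dist_triangle: "sup_dist f h \<le> sup_dist f g + sup_dist g h"
proof -
  have "ereal \<bar>f x - h x\<bar> \<le> sup_dist f g + sup_dist g h" for x
  proof -
    have "ereal \<bar>f x - h x\<bar> \<le> ereal \<bar>f x - g x\<bar> + ereal \<bar>g x - h x\<bar>"
      by simp
    also have "\<dots> \<le> sup_dist f g + sup_dist g h"
      by (intro add_mono sup_dist_upper)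
    finally show ?thesis .
  qed
  then show ?thesis
    unfolding sup_dist_def[of f h] by (intro SUP_least)
qed

lemma d_inf_nonneg: "0 \<le> d_inf f g"
proof -
  have "ereal 0 \<le> ereal (d_inf f g)"
    unfolding ereal_d_inf using sup_dist_nonneg[of f g] by (simp add: zero_ereal_def)
  then show ?thesis by simp
qed

lemma d_inf_triangle: "d_inf f h \<le> d_inf f g + d_inf g h"
proof -
  have "min c 1 \<le> min a 1 + min b 1" if "c \<le> a + b" "0 \<le> a" "0 \<le> b" for a b c :: ereal
    using that by (cases a; cases b; cases c) (auto simp: min_def one_ereal_def)
  from this[OF sup_dist_triangle[of f h g] sup_dist_nonneg sup_dist_nonneg]
  have "ereal (d_inf f h) \<le> ereal (d_inf f g + d_inf g h)"
    by (simp only: ereal_d_inf[symmetric] plus_ereal.simps)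
  then show ?thesis by simp
qed

lemma d_inf_eq_0_iff: "d_inf f g = 0 \<longleftrightarrow> f = g"
proof
  assume "d_inf f g = 0"
  then have "min (sup_dist f g) 1 = 0"
    using ereal_d_inf[of f g] by (simp add: zero_ereal_def)
  then have "sup_dist f g = 0"
    by (auto simp: min_def split: if_splits)
  then have "f x = g x" for x
    using sup_dist_upper[of f x g] by (simp add: zero_ereal_def)
  then show "f = g" by blast
next
  assume "f = g"
  then show "d_inf f g = 0"
    by (simp add: d_inf_def sup_dist_def zero_ereal_def[symmetric])
qed

interpretation C_R: Metric_space C_R d_inf
proof
  show "d_inf f g = d_inf g f" for f g
    by (simp add: d_inf_def sup_dist_def abs_minus_commute)
qed (simp_all add: d_inf_nonneg d_inf_eq_0_iff d_inf_triangle)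

definition l_infty :: "(int \<Rightarrow> real) set" where
  "l_infty = {x. bounded (range x)}"

definition universal :: "(real \<Rightarrow> real) set" where
  "universal = {f \<in> C_R. \<forall>x\<in>l_infty. \<exists>t. \<forall>n. x n = f (t + of_int n)}"

definition nearly_universal :: "(real \<Rightarrow> real) set" where
  "nearly_universal =
    {f \<in> C_R. \<forall>x\<in>l_infty. (INF t. SUP n. ereal \<bar>f (t + of_int n) - x n\<bar>) = 0}"

definition nowhere_dense_in :: "'a topology \<Rightarrow> 'a set \<Rightarrow> bool" where
  "nowhere_dense_in X S \<longleftrightarrow> S \<subseteq> topspace X \<and> X interior_of (X closure_of S) = {}"

end

theory Submission
  imports Defs
begin

text \<open>
  The idea: a curve in the plane can be pushed off a disc by a small perturbation, and the pairs
  \<open>(f t, f (t + 1))\<close> trace such curves. Fix \<open>f\<close> and a radius \<open>c\<close>, and let \<open>t\<close> run through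
  \<open>[2k, 2k + 1]\<close> for an integer \<open>k\<close>. For different \<open>k\<close> these pairs involve the values of \<open>f\<close> on
  the intervals \<open>[2k, 2k + 2]\<close>, which overlap only at even integers. So the plane
  curves \<open>t \<mapsto> (f t, f (t + 1))\<close> can be perturbed independently of each other, provided that the
  values of \<open>f\<close> at the integers, where adjacent pieces meet, stay as they are. The outcome is
  a continuous \<open>g\<close>, uniformly close to \<open>f\<close>, with \<open>\<bar>(g t, g (t + 1))\<bar> \<ge> c\<close> for all \<open>t\<close> in all these
  intervals. Every real \<open>t\<close> lies in one of them or has \<open>t - 1\<close> in one of them. Hence no orbit
  \<open>(g (t + n))\<^sub>n\<close> comes uniformly close to the zero sequence, with a bound that does not depend
  on \<open>t\<close>, and the same is true of all functions uniformly close to \<open>g\<close>. So every ball around \<open>f\<close>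
  contains a ball that has no nearly universal function in it.

  The push (\<open>push_curve_off_disc\<close>) rests on dimension: a map into the circle from a closed subset
  of an interval extends to the whole interval. A first perturbation (\<open>enlarge_at_integers\<close>)
  gives \<open>f\<close> absolute value at least \<open>c\<close> at the integers; the push then fixes these values, since
  it only moves points of the curve inside the disc.
\<close>

section \<open>Pushing a plane curve off a disc\<close>

text \<open>
  The part of the curve inside the disc is replaced by one on the bounding circle that agrees with
  it wherever \<open>\<gamma>\<close> meets the circle. That part may have infinitely many components; the extension
  theorem for maps from complexes of low dimension into spheres handles them all at once.
\<close>

lemma push_curve_off_disc:
  fixes \<gamma> :: "real \<Rightarrow> complex"
  assumes cont: "continuous_on {a..b} \<gamma>" and c: "c > 0"
  obtains \<gamma>' where "continuous_on {a..b} \<gamma>'"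
    and "\<And>t. t \<in> {a..b} \<Longrightarrow> c \<le> cmod (\<gamma> t) \<Longrightarrow> \<gamma>' t = \<gamma> t"
    and "\<And>t. t \<in> {a..b} \<Longrightarrow> c \<le> cmod (\<gamma>' t)"
    and "\<And>t. t \<in> {a..b} \<Longrightarrow> cmod (\<gamma>' t - \<gamma> t) \<le> 2 * c"
proof -
  let ?circle = "{t \<in> {a..b}. cmod (\<gamma> t) = c}"
  let ?inner = "{t \<in> {a..b}. cmod (\<gamma> t) \<le> c}"
  let ?outer = "{t \<in> {a..b}. c \<le> cmod (\<gamma> t)}"
  have norm_cont: "continuous_on {a..b} (\<lambda>t. cmod (\<gamma> t))"
    using cont by (intro continuous_intros)
  have closed_inner: "closed ?inner" and closed_outer: "closed ?outer"
    by (intro continuous_on_closed_Collect_le norm_cont continuous_on_const closed_atLeastAtMost)+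
  have "closed (?inner \<inter> ?outer)"
    using closed_inner closed_outer by blast
  also have "?inner \<inter> ?outer = ?circle"
    by auto
  finally have closed_circle: "closed ?circle" .
  have frontier: "rel_frontier (cball (0 :: complex) c) = sphere 0 c"
    using c by simp
  have dims: "aff_dim {a..b} < aff_dim (cball (0 :: complex) c)"
  proof -
    have "aff_dim {a..b} \<le> 1"
      using aff_dim_le_DIM[of "{a..b}"] by simp
    then show ?thesis
      using c by (simp add: aff_dim_cball)
  qed
  have "polytope {a..b}"
    using polytope_interval[of a b] by (simp add: cbox_interval)
  obtain \<eta> where \<eta>: "continuous_on (\<Union>{{a..b}}) \<eta>" "\<eta> \<in> \<Union>{{a..b}} \<rightarrow> rel_frontier (cball 0 c)"
      "\<And>t. t \<in> ?circle \<Longrightarrow> \<eta> t = \<gamma> t"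
  proof (rule extend_map_cell_complex_to_sphere[of "{{a..b}}" ?circle "cball (0 :: complex) c" \<gamma>])
    show "continuous_on ?circle \<gamma>"
      using cont by (rule continuous_on_subset) auto
    show "\<gamma> \<in> ?circle \<rightarrow> rel_frontier (cball 0 c)"
      unfolding frontier by auto
  qed (use closed_circle dims \<open>polytope {a..b}\<close> in \<open>auto simp: face_of_refl\<close>)
  define \<gamma>' where "\<gamma>' = (\<lambda>t. if cmod (\<gamma> t) \<le> c then \<eta> t else \<gamma> t)"
  have on_circle: "cmod (\<eta> t) = c" if "t \<in> {a..b}" for t
    using \<eta>(2) that unfolding frontier by auto
  have same: "\<gamma>' t = \<gamma> t" if "t \<in> {a..b}" "c \<le> cmod (\<gamma> t)" for t
    using that \<eta>(3)[of t] by (auto simp: \<gamma>'_def)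
  show ?thesis
  proof
    have "continuous_on (?inner \<union> ?outer) \<gamma>'"
      unfolding \<gamma>'_def
    proof (rule continuous_on_cases[OF closed_inner closed_outer])
      show "continuous_on ?inner \<eta>"
        using \<eta>(1) by (auto intro: continuous_on_subset)
      show "continuous_on ?outer \<gamma>"
        using cont by (rule continuous_on_subset) auto
      show "\<forall>t. t \<in> ?inner \<and> \<not> cmod (\<gamma> t) \<le> c \<or> t \<in> ?outer \<and> cmod (\<gamma> t) \<le> c \<longrightarrow> \<eta> t = \<gamma> t"
        using \<eta>(3) by auto
    qed
    moreover have "?inner \<union> ?outer = {a..b}"
      by auto
    ultimately show "continuous_on {a..b} \<gamma>'"
      by simp
    show "\<gamma>' t = \<gamma> t" if "t \<in> {a..b}" "c \<le> cmod (\<gamma> t)" for t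
      using that by (rule same)
    show "c \<le> cmod (\<gamma>' t)" if "t \<in> {a..b}" for t
      using on_circle[OF that] by (auto simp: \<gamma>'_def)
    show "cmod (\<gamma>' t - \<gamma> t) \<le> 2 * c" if "t \<in> {a..b}" for t
      using on_circle[OF that] norm_triangle_ineq4[of "\<eta> t" "\<gamma> t"] c by (auto simp: \<gamma>'_def)
  qed
qed

section \<open>Continuous functions on the line built from unit intervals\<close>

lemma continuous_glue_unit_intervals:
  fixes p :: "int \<Rightarrow> real \<Rightarrow> 'a :: topological_space"
  assumes cont: "\<And>n. continuous_on {of_int n..of_int n + 1} (p n)"
    and match: "\<And>n. p n (of_int n + 1) = p (n + 1) (of_int n + 1)"
  shows "continuous_on UNIV (\<lambda>t. p \<lfloor>t\<rfloor> t)"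
proof -
  have on_piece: "p \<lfloor>t\<rfloor> t = p n t" if t: "t \<in> {of_int n..of_int n + 1}" for n t
  proof (cases "t = of_int n + 1")
    case True
    then show ?thesis
      using match[of n] by simp
  next
    case False
    with t have "\<lfloor>t\<rfloor> = n"
      by (intro floor_unique) auto
    then show ?thesis
      by simp
  qed
  have piece: "continuous_on {of_int n..of_int n + 1} (\<lambda>t. p \<lfloor>t\<rfloor> t)" for n
    using continuous_on_cong[THEN iffD2, OF refl on_piece cont] .
  have "isCont (\<lambda>t. p \<lfloor>t\<rfloor> t) t" for t
  proof -
    let ?n = "of_int \<lfloor>t\<rfloor> :: real"
    have left: "continuous_on {?n - 1..?n} (\<lambda>t. p \<lfloor>t\<rfloor> t)"
      using piece[of "\<lfloor>t\<rfloor> - 1"] by simp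
    have "continuous_on ({?n - 1..?n} \<union> {?n..?n + 1}) (\<lambda>t. p \<lfloor>t\<rfloor> t)"
      by (intro continuous_on_closed_Un left piece) auto
    then have "continuous_on {?n - 1<..<?n + 1} (\<lambda>t. p \<lfloor>t\<rfloor> t)"
      by (rule continuous_on_subset) auto
    moreover have "t \<in> {?n - 1<..<?n + 1}"
      using floor_correct[of t] by simp linarith
    ultimately show ?thesis
      using continuous_on_eq_continuous_at[OF open_greaterThanLessThan] by blast
  qed
  then show ?thesis
    by (simp add: continuous_at_imp_continuous_on)
qed

section \<open>Orbits that stay away from the zero sequence\<close>

text \<open>
  Adding \<open>\<plusminus>c\<close> at an integer, with the sign of the value there, brings the absolute value to at
  least \<open>c\<close>. As the integers are closed and discrete, Tietze's theorem extends this correction.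
\<close>

lemma enlarge_at_integers:
  fixes f :: "real \<Rightarrow> real"
  assumes cont: "continuous_on UNIV f" and c: "c \<ge> 0"
  obtains g where "continuous_on UNIV g" and "\<And>t. \<bar>g t - f t\<bar> \<le> c"
    and "\<And>n :: int. c \<le> \<bar>g (of_int n)\<bar>"
proof -
  define s where "s t = (if f t \<ge> 0 then c else - c)" for t
  have "uniform_discrete (\<int> :: real set)"
    unfolding uniform_discrete_def
    by (intro exI[of _ "1 :: real"]) (auto simp: dist_real_def elim!: Ints_cases)
  then have "discrete (\<int> :: real set)"
    by (rule uniform_discrete_imp_discrete)
  then have "continuous_on \<int> s"
    by (rule continuous_on_discrete)
  moreover have "closedin (top_of_set UNIV) (\<int> :: real set)"
    by simp
  moreover have "norm (s t) \<le> c" for t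
    using c by (simp add: s_def)
  ultimately obtain s' where s': "continuous_on UNIV s'" "\<And>t. t \<in> \<int> \<Longrightarrow> s' t = s t"
      "\<And>t. t \<in> UNIV \<Longrightarrow> norm (s' t) \<le> c"
    using Tietze[of \<int> s UNIV c] c by metis
  show ?thesis
  proof
    show "continuous_on UNIV (\<lambda>t. f t + s' t)"
      using cont s'(1) by (intro continuous_intros)
    show "\<bar>f t + s' t - f t\<bar> \<le> c" for t
      using s'(3)[of t] by simp
    show "c \<le> \<bar>f (of_int n) + s' (of_int n)\<bar>" for n :: int
      using s'(2)[of "of_int n"] c by (auto simp: s_def)
  qed
qed

text \<open>
  The pieces of \<open>g\<close> on \<open>[2k, 2k + 1]\<close> and \<open>[2k + 1, 2k + 2]\<close> are the real and the imaginary part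
  of one pushed curve, parametrised over \<open>[0, 1]\<close>. If the curve has modulus at least \<open>c\<close>, then
  one of its two coordinates is at least \<open>c / 2\<close> in absolute value.
\<close>

lemma approx_orbits_avoid_zero:
  fixes f :: "real \<Rightarrow> real"
  assumes cont: "continuous_on UNIV f" and c: "c > 0"
  obtains g where "continuous_on UNIV g" and "\<And>t. \<bar>g t - f t\<bar> \<le> 3 * c"
    and "\<And>t. \<exists>n :: int. c / 2 \<le> \<bar>g (t + of_int n)\<bar>"
proof -
  obtain h where h: "continuous_on UNIV h" and h_close: "\<And>t. \<bar>h t - f t\<bar> \<le> c"
    and h_int: "\<And>n :: int. c \<le> \<bar>h (of_int n)\<bar>"
    using enlarge_at_integers[OF cont less_imp_le[OF c]] by blast
  define \<gamma> where "\<gamma> k s = Complex (h (of_int (2 * k) + s)) (h (of_int (2 * k + 1) + s))"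
    for k :: int and s :: real
  have "\<exists>\<gamma>'. continuous_on {0..1} \<gamma>' \<and>
      (\<forall>s\<in>{0..1}. c \<le> cmod (\<gamma> k s) \<longrightarrow> \<gamma>' s = \<gamma> k s) \<and>
      (\<forall>s\<in>{0..1}. c \<le> cmod (\<gamma>' s)) \<and> (\<forall>s\<in>{0..1}. cmod (\<gamma>' s - \<gamma> k s) \<le> 2 * c)" for k
  proof -
    have "continuous_on {0..1} (\<gamma> k)"
      unfolding \<gamma>_def
      by (intro continuous_on_Complex continuous_on_compose2[OF h] continuous_intros) auto
    from push_curve_off_disc[OF this c] show ?thesis
      by metis
  qed
  then obtain \<gamma>' where \<gamma>'_cont: "\<And>k. continuous_on {0..1} (\<gamma>' k)"
    and \<gamma>'_same: "\<And>k s. s \<in> {0..1} \<Longrightarrow> c \<le> cmod (\<gamma> k s) \<Longrightarrow> \<gamma>' k s = \<gamma> k s"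
    and \<gamma>'_far: "\<And>k s. s \<in> {0..1} \<Longrightarrow> c \<le> cmod (\<gamma>' k s)"
    and \<gamma>'_close: "\<And>k s. s \<in> {0..1} \<Longrightarrow> cmod (\<gamma>' k s - \<gamma> k s) \<le> 2 * c"
    by metis
  define part :: "int \<Rightarrow> complex \<Rightarrow> real" where "part n = (if even n then Re else Im)" for n
  have part_cont: "continuous_on A (\<lambda>x. part n (F x))" if "continuous_on A F"
    for n A and F :: "real \<Rightarrow> complex"
    using that by (auto simp: part_def intro: continuous_intros)
  have part_diff: "\<bar>part n z - part n w\<bar> \<le> cmod (z - w)" for n z w
    using abs_Re_le_cmod[of "z - w"] abs_Im_le_cmod[of "z - w"] by (simp add: part_def)
  have part_\<gamma>: "part n (\<gamma> (n div 2) (t - of_int n)) = h t" for n t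
  proof (cases "even n")
    case True
    then show ?thesis
      by (auto simp: part_def \<gamma>_def elim!: evenE)
  next
    case False
    then show ?thesis
      by (auto simp: part_def \<gamma>_def elim!: oddE)
  qed
  define p where "p n t = part n (\<gamma>' (n div 2) (t - of_int n))" for n t
  define g where "g t = p \<lfloor>t\<rfloor> t" for t
  have ends: "\<gamma>' k s = \<gamma> k s" if "s = 0 \<or> s = 1" for k s
  proof (rule \<gamma>'_same)
    have "c \<le> \<bar>h (of_int (2 * k) + s)\<bar>"
      using that h_int[of "2 * k"] h_int[of "2 * k + 1"] by auto
    also have "\<dots> \<le> cmod (\<gamma> k s)"
      using abs_Re_le_cmod[of "\<gamma> k s"] by (simp add: \<gamma>_def)
    finally show "c \<le> cmod (\<gamma> k s)" .
  qed (use that in auto)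
  have p_ends: "p n (of_int n) = h (of_int n)" "p n (of_int n + 1) = h (of_int n + 1)" for n
    using part_\<gamma>[of n "of_int n"] part_\<gamma>[of n "of_int n + 1"] by (simp_all add: p_def ends)
  show ?thesis
  proof
    show "continuous_on UNIV g"
      unfolding g_def
    proof (rule continuous_glue_unit_intervals)
      show "continuous_on {of_int n..of_int n + 1} (p n)" for n
        unfolding p_def
        by (intro part_cont continuous_on_compose2[OF \<gamma>'_cont] continuous_intros) auto
      show "p n (of_int n + 1) = p (n + 1) (of_int n + 1)" for n
        using p_ends(2)[of n] p_ends(1)[of "n + 1"] by simp
    qed
    show "\<bar>g t - f t\<bar> \<le> 3 * c" for t
    proof -
      have "t - of_int \<lfloor>t\<rfloor> \<in> {0..1}"
        using floor_correct[of t] by simp linarith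
      from order_trans[OF part_diff \<gamma>'_close[OF this]]
      have "\<bar>g t - h t\<bar> \<le> 2 * c"
        by (metis g_def p_def part_\<gamma>)
      with h_close[of t] show ?thesis
        by linarith
    qed
    show "\<exists>n :: int. c / 2 \<le> \<bar>g (t + of_int n)\<bar>" for t
    proof -
      define k s where "k = \<lfloor>t\<rfloor> div 2" and "s = t - of_int \<lfloor>t\<rfloor>"
      have s: "0 \<le> s" "s < 1"
        using floor_correct[of t] by (auto simp: s_def) linarith
      have floors: "\<lfloor>of_int m + s\<rfloor> = m" for m :: int
        using s by (intro floor_unique) auto
      have "g (of_int (2 * k) + s) = Re (\<gamma>' k s)" "g (of_int (2 * k + 1) + s) = Im (\<gamma>' k s)"
        unfolding g_def floors by (simp_all add: p_def part_def)
      moreover have "c \<le> \<bar>Re (\<gamma>' k s)\<bar> + \<bar>Im (\<gamma>' k s)\<bar>"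
        using \<gamma>'_far[of s k] cmod_le[of "\<gamma>' k s"] s by simp
      ultimately obtain m :: int where m: "c / 2 \<le> \<bar>g (of_int m + s)\<bar>"
        by (metis add_strict_mono field_sum_of_halves not_le)
      have "of_int m + s = t + of_int (m - \<lfloor>t\<rfloor>)"
        by (simp add: s_def)
      with m show ?thesis
        by metis
    qed
  qed
qed

section \<open>Nowhere density\<close>

lemma d_inf_le:
  assumes "\<And>x. \<bar>f x - g x\<bar> \<le> e"
  shows "d_inf f g \<le> e"
proof -
  have "sup_dist f g \<le> ereal e"
    unfolding sup_dist_def using assms by (intro SUP_least) simp
  then have "ereal (d_inf f g) \<le> ereal e"
    unfolding ereal_d_inf by (rule min.coboundedI1)
  then show ?thesis
    by simp
qed

text \<open>The bound \<open>e \<le> 1\<close> is there because \<^const>\<open>d_inf\<close> is cut off at \<open>1\<close>.\<close>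

lemma d_inf_less_imp_pointwise:
  assumes "d_inf f g < e" "e \<le> 1"
  shows "\<bar>f x - g x\<bar> < e"
proof -
  have "ereal (d_inf f g) < ereal e"
    using assms(1) by simp
  then have "min (sup_dist f g) 1 < ereal e"
    unfolding ereal_d_inf .
  with assms(2) have "sup_dist f g < ereal e"
    by (auto simp: min_def one_ereal_def split: if_splits)
  with sup_dist_upper[of f x g] have "ereal \<bar>f x - g x\<bar> < ereal e"
    by (rule order_le_less_trans)
  then show ?thesis
    by simp
qed

lemma orbits_avoid_zero_imp_not_nearly_universal:
  assumes e: "e > 0" and far: "\<And>t. \<exists>n :: int. e \<le> \<bar>f (t + of_int n)\<bar>"
  shows "f \<notin> nearly_universal"
proof
  assume "f \<in> nearly_universal"
  moreover have "(\<lambda>_. 0) \<in> l_infty"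
    by (simp add: l_infty_def)
  ultimately have zero: "(INF t. SUP n :: int. ereal \<bar>f (t + of_int n) - 0\<bar>) = 0"
    unfolding nearly_universal_def by fastforce
  have "ereal e \<le> (INF t. SUP n :: int. ereal \<bar>f (t + of_int n) - 0\<bar>)"
  proof (rule INF_greatest)
    fix t
    obtain n :: int where "e \<le> \<bar>f (t + of_int n)\<bar>"
      using far by blast
    then show "ereal e \<le> (SUP n :: int. ereal \<bar>f (t + of_int n) - 0\<bar>)"
      by (intro SUP_upper2[of n]) auto
  qed
  with zero e show False
    by simp
qed

lemma (in Metric_space) nowhere_dense_in_mtopologyI:
  assumes "S \<subseteq> M"
    and "\<And>x r. x \<in> M \<Longrightarrow> r > 0 \<Longrightarrow> \<exists>y\<in>mball x r. \<exists>e>0. mball y e \<inter> S = {}"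
  shows "nowhere_dense_in mtopology S"
  unfolding nowhere_dense_in_def
proof
  show "S \<subseteq> topspace mtopology"
    using assms(1) by simp
  show "mtopology interior_of (mtopology closure_of S) = {}"
  proof (rule ccontr)
    assume "mtopology interior_of (mtopology closure_of S) \<noteq> {}"
    then obtain x r where "x \<in> M" "r > 0" and sub: "mball x r \<subseteq> mtopology closure_of S"
      by (auto simp: metric_interior_of)
    then obtain y e where y: "y \<in> mball x r" and "e > 0" "mball y e \<inter> S = {}"
      using assms(2) by blast
    moreover have "y \<in> mtopology closure_of S"
      using y sub by blast
    ultimately show False
      unfolding metric_closure_of by blast
  qed
qed

lemma nowhere_dense_in_subset:
  assumes "nowhere_dense_in X S" "T \<subseteq> S"
  shows "nowhere_dense_in X T"
  using assms interior_of_mono[OF closure_of_mono[OF assms(2)], of X X]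
  unfolding nowhere_dense_in_def by blast

lemma universal_subset_nearly_universal: "universal \<subseteq> nearly_universal"
proof
  fix f
  assume f: "f \<in> universal"
  have "(INF t. SUP n :: int. ereal \<bar>f (t + of_int n) - x n\<bar>) = 0" if x: "x \<in> l_infty" for x
  proof (rule antisym)
    obtain t where "\<And>n. x n = f (t + of_int n)"
      using f x unfolding universal_def by blast
    then show "(INF t. SUP n :: int. ereal \<bar>f (t + of_int n) - x n\<bar>) \<le> 0"
      by (intro INF_lower2[of t]) (auto simp: zero_ereal_def)
    show "0 \<le> (INF t. SUP n :: int. ereal \<bar>f (t + of_int n) - x n\<bar>)"
      by (intro INF_greatest SUP_upper2[of 0]) auto
  qed
  with f show "f \<in> nearly_universal"
    by (simp add: nearly_universal_def universal_def)
qed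

theorem corollary1p2:
  shows "nowhere_dense_in C_R.mtopology nearly_universal \<and>
         nowhere_dense_in C_R.mtopology universal"
proof
  show nowhere_dense: "nowhere_dense_in C_R.mtopology nearly_universal"
  proof (rule C_R.nowhere_dense_in_mtopologyI)
    show "nearly_universal \<subseteq> C_R"
      by (auto simp: nearly_universal_def)
    fix f and r :: real
    assume f: "f \<in> C_R" and r: "r > 0"
    define c where "c = min r 1 / 4"
    have c: "c > 0" "3 * c < r" "c / 4 \<le> 1"
      using r by (auto simp: c_def)
    obtain g where g: "continuous_on UNIV g" and close: "\<And>t. \<bar>g t - f t\<bar> \<le> 3 * c"
      and far: "\<And>t. \<exists>n :: int. c / 2 \<le> \<bar>g (t + of_int n)\<bar>"
      using approx_orbits_avoid_zero[OF _ c(1), of f] f by (auto simp: C_R_def)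
    have "d_inf f g \<le> 3 * c"
      using close by (intro d_inf_le) (simp add: abs_minus_commute)
    moreover have "g \<in> C_R"
      using g by (simp add: C_R_def)
    ultimately have "g \<in> C_R.mball f r"
      using f c(2) by simp
    moreover have "C_R.mball g (c / 4) \<inter> nearly_universal = {}"
    proof -
      have "h \<notin> nearly_universal" if h: "d_inf g h < c / 4" for h
      proof (rule orbits_avoid_zero_imp_not_nearly_universal)
        show "c / 4 > 0"
          using c(1) by simp
        show "\<exists>n :: int. c / 4 \<le> \<bar>h (t + of_int n)\<bar>" for t
        proof -
          obtain n :: int where "c / 2 \<le> \<bar>g (t + of_int n)\<bar>"
            using far by blast
          with d_inf_less_imp_pointwise[OF h c(3), of "t + of_int n"]
          have "c / 4 \<le> \<bar>h (t + of_int n)\<bar>"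
            by linarith
          then show ?thesis ..
        qed
      qed
      then show ?thesis
        by auto
    qed
    ultimately show "\<exists>g\<in>C_R.mball f r. \<exists>e>0. C_R.mball g e \<inter> nearly_universal = {}"
      using c(1) by (intro bexI[of _ g] exI[of _ "c / 4"]) auto
  qed
  show "nowhere_dense_in C_R.mtopology universal"
    using nowhere_dense universal_subset_nearly_universal by (rule nowhere_dense_in_subset)
qed

end
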